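(* Let $A_1, A_2$ be complex square matrices of the same size, and let $\alpha\ge 0$ be a real number with $\|A_1\|\le \alpha/2$ and $\|A_2\|\le \alpha/2$. Then for every integer $n\ge 1$, $$\left\| \left\{ \exp[A_1/n]\,\exp[A_2/n] \right\}^n - \exp\left[ \langle A\rangle + L_A/n + R_A/n^2 \right] \right\| \le \frac{a}{n^3},$$ where, with $[X,Y]=XY-YX$, $$\langle A\rangle = A_1 + A_2,\qquad L_A = \tfrac12 [A_1,A_2],\qquad R_A = \tfrac{1}{12}[A_1,[A_1,A_2]] - \tfrac1{12}[A_2,[A_1,A_2]],$$ $$a = \frac{\alpha^4}{4}\,\exp[3\alpha]\,\exp[\alpha^2]\,\exp[\alpha^3].$$
   Context: $\exp$ denotes the matrix exponential. $\|\cdot\|$ denotes a submultiplicative matrix norm with $\|I\|=1$ for the identity matrix $I$ (e.g. an operator norm). *)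

theory Defs
  imports "HOL-Analysis.Analysis"
begin

text \<open>
  On \<open>complex ^ 'n ^ 'n\<close> the library's \<open>*\<close>, \<open>^\<close> and \<open>1\<close> act entrywise, so matrix powers
  and the matrix exponential are built here from \<open>**\<close> and \<open>mat 1\<close>.
\<close>

primrec matrix_pow :: "complex ^ 'n ^ 'n \<Rightarrow> nat \<Rightarrow> complex ^ 'n ^ 'n" where
  "matrix_pow A 0 = mat 1"
| "matrix_pow A (Suc k) = A ** matrix_pow A k"

text \<open>
  The sum is taken in the standard topology of \<open>complex ^ 'n ^ 'n\<close>; it always converges
  (see \<open>summable_matrix_exp\<close>).
\<close>

definition matrix_exp :: "complex ^ 'n ^ 'n \<Rightarrow> complex ^ 'n ^ 'n" where
  "matrix_exp A = (\<Sum>k. matrix_pow A k /\<^sub>R fact k)"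

definition commutator :: "complex ^ 'n ^ 'n \<Rightarrow> complex ^ 'n ^ 'n \<Rightarrow> complex ^ 'n ^ 'n" where
  "commutator X Y = X ** Y - Y ** X"

text \<open>
  Entries are scaled by complex scalars; \<open>*\<^sub>R\<close> would only provide real homogeneity.
\<close>

definition submultiplicative_matrix_norm :: "(complex ^ 'n ^ 'n \<Rightarrow> real) \<Rightarrow> bool" where
  "submultiplicative_matrix_norm N \<longleftrightarrow>
     (\<forall>A. 0 \<le> N A) \<and>
     (\<forall>A. N A = 0 \<longleftrightarrow> A = 0) \<and>
     (\<forall>c A. N (\<chi> i j. c * A $ i $ j) = cmod c * N A) \<and>
     (\<forall>A B. N (A + B) \<le> N A + N B) \<and>
     (\<forall>A B. N (A ** B) \<le> N A * N B) \<and>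
     N (mat 1) = 1"

lemma bounded_bilinear_matrix_mult:
  "bounded_bilinear ((**) :: complex ^ 'n ^ 'n \<Rightarrow> complex ^ 'n ^ 'n \<Rightarrow> complex ^ 'n ^ 'n)"
proof -
  have "bilinear ((**) :: complex ^ 'n ^ 'n \<Rightarrow> complex ^ 'n ^ 'n \<Rightarrow> complex ^ 'n ^ 'n)"
    unfolding bilinear_def
    by (auto intro!: linearI simp: matrix_matrix_mult_def vec_eq_iff distrib_left distrib_right
        sum.distrib scaleR_sum_right)
  then show ?thesis
    by (simp add: bilinear_conv_bounded_bilinear)
qed

lemma summable_matrix_exp:
  fixes A :: "complex ^ 'n ^ 'n"
  shows "summable (\<lambda>k. matrix_pow A k /\<^sub>R fact k)"
proof -
  obtain K where K: "K > 0"
    "\<And>(X :: complex ^ 'n ^ 'n) (Y :: complex ^ 'n ^ 'n). norm (X ** Y) \<le> norm X * norm Y * K"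
    using bounded_bilinear.pos_bounded[OF bounded_bilinear_matrix_mult] by metis
  define M :: real where "M = norm (mat 1 :: complex ^ 'n ^ 'n)"
  define x where "x = norm A * K"
  have x: "0 \<le> x" using K(1) by (simp add: x_def)
  have pow: "norm (matrix_pow A k) \<le> M * x ^ k" for k
  proof (induction k)
    case 0
    show ?case by (simp add: M_def)
  next
    case (Suc k)
    have "norm (matrix_pow A (Suc k)) \<le> norm A * norm (matrix_pow A k) * K"
      using K(2) by simp
    also have "\<dots> = x * norm (matrix_pow A k)"
      by (simp add: x_def)
    also have "\<dots> \<le> x * (M * x ^ k)"
      using Suc x by (rule mult_left_mono)
    finally show ?case by (simp add: mult_ac)
  qed
  have "summable (\<lambda>k. M * (x ^ k /\<^sub>R fact k))"
    by (intro summable_mult summable_exp_generic)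
  then show ?thesis
  proof (rule summable_comparison_test')
    show "norm (matrix_pow A k /\<^sub>R fact k) \<le> M * (x ^ k /\<^sub>R fact k)" if "k \<ge> 0" for k
      using mult_left_mono[OF pow[of k], of "inverse (fact k)"] by (simp add: mult_ac)
  qed
qed

end

theory Submission
  imports Defs
begin

text \<open>
  Put \<open>x = A1 / n\<close>, \<open>y = A2 / n\<close>, \<open>u = \<alpha> / n\<close>, and let \<open>z\<close> be the Baker-Campbell-Hausdorff series
  of \<open>x\<close> and \<open>y\<close> truncated after degree 3, so that the second exponential is \<open>G ^ n\<close> with
  \<open>G = exp z\<close>; let \<open>F = exp x exp y\<close>. Telescoping reduces the claim to a bound on \<open>F - G\<close>. The two
  expansions agree up to degree 3, and in degree 4 they differ exactly by
  \<open>- [y, [x, [x, y]]] / 24\<close>, of norm at most \<open>u ^ 4 / 48\<close>. This cancellation is needed: bounding the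
  degree 4 parts of \<open>F\<close> and \<open>G\<close> separately gives more than \<open>u ^ 4 / 4\<close>. The terms of degree at
  least 5 are bounded by their scalar majorants.
\<close>

section \<open>Matrix algebra and the exponential series\<close>

lemma
  fixes A B C :: "complex ^ 'n ^ 'n"
  shows matrix_add_rdistrib: "(A + B) ** C = A ** C + B ** C"
    and matrix_diff_ldistrib: "A ** (B - C) = A ** B - A ** C"
    and matrix_diff_rdistrib: "(A - B) ** C = A ** C - B ** C"
    and matrix_scaleR_left: "(r *\<^sub>R A) ** B = r *\<^sub>R (A ** B)"
    and matrix_scaleR_right: "A ** (r *\<^sub>R B) = r *\<^sub>R (A ** B)"
  by (rule bounded_bilinear.add_left[OF bounded_bilinear_matrix_mult]
      bounded_bilinear.diff_right[OF bounded_bilinear_matrix_mult]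
      bounded_bilinear.diff_left[OF bounded_bilinear_matrix_mult]
      bounded_bilinear.scaleR_left[OF bounded_bilinear_matrix_mult]
      bounded_bilinear.scaleR_right[OF bounded_bilinear_matrix_mult])+

lemmas matrix_algebra_simps =
  matrix_add_ldistrib matrix_add_rdistrib matrix_diff_ldistrib matrix_diff_rdistrib
  matrix_scaleR_left matrix_scaleR_right matrix_mul_assoc

text \<open>For identities that \<open>matrix_algebra_simps\<close> has expanded into words: as
  \<open>**\<close> stays folded, each entry becomes a linear identity over the complex numbers
  whose atoms are the entries of the words.\<close>

lemmas matrix_entry_simps =
  vec_eq_iff vector_add_component vector_minus_component vector_scaleR_component
  scaleR_conv_of_real[where 'a = complex]

lemma matrix_pow_scaleR: "matrix_pow (r *\<^sub>R A) k = r ^ k *\<^sub>R matrix_pow A k"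
  by (induction k) (simp_all add: matrix_scaleR_left matrix_scaleR_right mult.commute)

lemma matrix_pow_add: "matrix_pow A (j + k) = matrix_pow A j ** matrix_pow A k"
  by (induction j) (simp_all add: matrix_mul_assoc)

lemma matrix_exp_sums: "(\<lambda>k. matrix_pow A k /\<^sub>R fact k) sums matrix_exp A"
  unfolding matrix_exp_def by (rule summable_sums[OF summable_matrix_exp])

lemma sums_vec_nth: "f sums S \<Longrightarrow> (\<lambda>k. f k $ i) sums (S $ i)"
  unfolding sums_def by (drule tendsto_vec_nth[where i = i]) (simp add: sum_component)

lemma sums_vec: "(\<And>i. (\<lambda>k. f k $ i) sums (S $ i)) \<Longrightarrow> f sums S"
  unfolding sums_def by (rule vec_tendstoI) (simp add: sum_component)

lemma summable_norm_matrix_exp: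
  fixes A :: "complex ^ 'n ^ 'n"
  shows "summable (\<lambda>k. norm (matrix_pow A k /\<^sub>R fact k))"
proof -
  \<comment> \<open>As for power series: convergence at \<open>2 *\<^sub>R A\<close> gives absolute convergence at \<open>A\<close>.\<close>
  obtain K where K: "\<And>k. norm (matrix_pow (2 *\<^sub>R A) k /\<^sub>R fact k) \<le> K"
    using summable_imp_Bseq[OF summable_matrix_exp] unfolding Bseq_def by blast
  have "norm (norm (matrix_pow A k /\<^sub>R fact k)) \<le> K * (1/2) ^ k" for k
    using K[of k] by (simp add: matrix_pow_scaleR field_simps)
  moreover have "summable (\<lambda>k. K * (1/2) ^ k)"
    by (intro summable_mult summable_geometric) simp
  ultimately show ?thesis
    by (blast intro: summable_comparison_test')
qed

text \<open>An entry of a matrix product is a finite sum over \<open>k\<close> of products of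
  complex numbers, so the scalar Cauchy product applies for each \<open>k\<close>, given absolute
  convergence of the entry series.\<close>

lemma matrix_exp_Cauchy_product:
  fixes A B :: "complex ^ 'n ^ 'n"
  shows "(\<lambda>m. \<Sum>p\<le>m. (matrix_pow A p /\<^sub>R fact p) ** (matrix_pow B (m - p) /\<^sub>R fact (m - p)))
    sums (matrix_exp A ** matrix_exp B)"
proof (intro sums_vec)
  fix i j
  let ?a = "\<lambda>k. matrix_pow A k /\<^sub>R fact k" and ?b = "\<lambda>k. matrix_pow B k /\<^sub>R fact k"
  have entry: "(\<lambda>k. (matrix_pow C k /\<^sub>R fact k) $ i $ j) sums (matrix_exp C $ i $ j)"
    for C :: "complex ^ 'n ^ 'n" and i j
    by (intro sums_vec_nth matrix_exp_sums)
  have abs: "summable (\<lambda>k. norm ((matrix_pow C k /\<^sub>R fact k) $ i $ j))"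
    for C :: "complex ^ 'n ^ 'n" and i j
  proof (rule summable_comparison_test'[OF summable_norm_matrix_exp[of C]])
    show "norm (norm ((matrix_pow C k /\<^sub>R fact k) $ i $ j)) \<le> norm (matrix_pow C k /\<^sub>R fact k)" for k
      using order_trans[OF Finite_Cartesian_Product.norm_nth_le Finite_Cartesian_Product.norm_nth_le]
      by (simp only: real_norm_def abs_norm_cancel)
  qed
  have "(\<lambda>m. \<Sum>p\<le>m. ?a p $ i $ k * ?b (m - p) $ k $ j) sums (matrix_exp A $ i $ k * matrix_exp B $ k $ j)"
    for k
    using Cauchy_product_sums[OF abs[of A i k] abs[of B k j]]
    by (simp only: sums_unique[OF entry, symmetric])
  then have "(\<lambda>m. \<Sum>k\<in>UNIV. \<Sum>p\<le>m. ?a p $ i $ k * ?b (m - p) $ k $ j) sums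
      (\<Sum>k\<in>UNIV. matrix_exp A $ i $ k * matrix_exp B $ k $ j)"
    by (rule sums_sum)
  then show "(\<lambda>m. (\<Sum>p\<le>m. ?a p ** ?b (m - p)) $ i $ j) sums ((matrix_exp A ** matrix_exp B) $ i $ j)"
    by (subst (asm) sum.swap) (simp add: sum_component matrix_matrix_mult_def)
qed

text \<open>In the Cauchy product every term of degree \<open>m\<close> is a multiple of
  \<open>matrix_pow A m\<close>, and the binomial theorem sums the coefficients.\<close>

lemma matrix_exp_add_scaleR:
  "matrix_exp (s *\<^sub>R A) ** matrix_exp (t *\<^sub>R A) = matrix_exp ((s + t) *\<^sub>R A)"
proof (rule sums_unique2[OF matrix_exp_Cauchy_product])
  have "(\<Sum>p\<le>m. (matrix_pow (s *\<^sub>R A) p /\<^sub>R fact p) ** (matrix_pow (t *\<^sub>R A) (m - p) /\<^sub>R fact (m - p)))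
      = matrix_pow ((s + t) *\<^sub>R A) m /\<^sub>R fact m" (is "?l = ?r") for m
  proof -
    have "?l = (\<Sum>p\<le>m. ((s ^ p / fact p) * (t ^ (m - p) / fact (m - p))) *\<^sub>R matrix_pow A m)"
    proof (rule sum.cong)
      fix p assume "p \<in> {..m}"
      then have "matrix_pow A p ** matrix_pow A (m - p) = matrix_pow A m"
        by (simp flip: matrix_pow_add)
      then show "(matrix_pow (s *\<^sub>R A) p /\<^sub>R fact p) ** (matrix_pow (t *\<^sub>R A) (m - p) /\<^sub>R fact (m - p))
          = ((s ^ p / fact p) * (t ^ (m - p) / fact (m - p))) *\<^sub>R matrix_pow A m"
        by (simp add: matrix_pow_scaleR matrix_scaleR_left matrix_scaleR_right field_simps)
    qed simp
    also have "\<dots> = (\<Sum>p\<le>m. (s ^ p / fact p) * (t ^ (m - p) / fact (m - p))) *\<^sub>R matrix_pow A m"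
      by (simp add: scaleR_sum_left)
    also have "(\<Sum>p\<le>m. (s ^ p / fact p) * (t ^ (m - p) / fact (m - p))) = (s + t) ^ m / fact m"
      by (simp add: binomial_ring sum_divide_distrib binomial_fact field_simps)
    finally show ?thesis by (simp add: matrix_pow_scaleR divide_inverse_commute)
  qed
  then show "(\<lambda>m. \<Sum>p\<le>m. (matrix_pow (s *\<^sub>R A) p /\<^sub>R fact p) ** (matrix_pow (t *\<^sub>R A) (m - p) /\<^sub>R fact (m - p)))
      sums matrix_exp ((s + t) *\<^sub>R A)"
    using matrix_exp_sums[of "(s + t) *\<^sub>R A"] by simp
qed

lemma matrix_exp_zero: "matrix_exp 0 = (mat 1 :: complex ^ 'n ^ 'n)"
proof (rule sums_unique2[OF matrix_exp_sums])
  have "(\<lambda>k. matrix_pow 0 k /\<^sub>R fact k) = (\<lambda>k. if k = 0 then mat 1 else (0 :: complex ^ 'n ^ 'n))"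
  proof
    show "matrix_pow 0 k /\<^sub>R fact k = (if k = 0 then mat 1 else (0 :: complex ^ 'n ^ 'n))" for k
      by (cases k) (simp_all add: matrix_matrix_mult_def vec_eq_iff)
  qed
  then show "(\<lambda>k. matrix_pow 0 k /\<^sub>R fact k) sums (mat 1 :: complex ^ 'n ^ 'n)"
    using sums_single[of 0 "\<lambda>_. mat 1"] by (simp only:)
qed

text \<open>Lets the second exponential of the theorem be read as an \<open>n\<close>-th power, the
  form that telescoping requires.\<close>

lemma matrix_pow_exp: "matrix_pow (matrix_exp A) k = matrix_exp (real k *\<^sub>R A)"
proof (induction k)
  case (Suc k)
  then show ?case using matrix_exp_add_scaleR[of 1 A "real k"] by simp
qed (simp add: matrix_exp_zero)

section \<open>Estimates in an arbitrary submultiplicative norm\<close>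

locale submultiplicative_norm =
  fixes N :: "complex ^ 'n ^ 'n \<Rightarrow> real"
  assumes N: "submultiplicative_matrix_norm N"
begin

lemma nonneg [simp]: "0 \<le> N A"
  and triangle: "N (A + B) \<le> N A + N B"
  and mult: "N (A ** B) \<le> N A * N B"
  and one [simp]: "N (mat 1) = 1"
  and zero [simp]: "N 0 = 0"
  using N unfolding submultiplicative_matrix_norm_def by blast+

lemma scaleR [simp]: "N (r *\<^sub>R A) = \<bar>r\<bar> * N A"
proof -
  have "N (\<chi> i j. of_real r * A $ i $ j) = cmod (of_real r) * N A"
    using N unfolding submultiplicative_matrix_norm_def by blast
  moreover have "(\<chi> i j. of_real r * A $ i $ j) = r *\<^sub>R A"
    by (simp add: vec_eq_iff scaleR_conv_of_real[where 'a = complex])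
  ultimately show ?thesis by simp
qed

lemma minus [simp]: "N (- A) = N A"
  using scaleR[of "-1" A] by simp

lemma diff_le: "N (A - B) \<le> N A + N B"
  using triangle[of A "- B"] by simp

lemma sum_le: "N (sum f I) \<le> (\<Sum>i\<in>I. N (f i))"
proof (induction I rule: infinite_finite_induct)
  case (insert x F)
  then show ?case using triangle[of "f x" "sum f F"] by simp
qed simp_all

lemma add_mono: "N A \<le> a \<Longrightarrow> N B \<le> b \<Longrightarrow> N (A + B) \<le> a + b"
  using triangle[of A B] by simp

lemma diff_mono: "N A \<le> a \<Longrightarrow> N B \<le> b \<Longrightarrow> N (A - B) \<le> a + b"
  using diff_le[of A B] by simp

lemma mult_mono: "N A \<le> a \<Longrightarrow> N B \<le> b \<Longrightarrow> N (A ** B) \<le> a * b"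
  by (meson Rings.mult_mono mult nonneg order_trans)

lemma scaleR_mono: "N A \<le> a \<Longrightarrow> 0 \<le> r \<Longrightarrow> N (r *\<^sub>R A) \<le> r * a"
  by (simp add: mult_left_mono)

lemma pow_mono: "N A \<le> a \<Longrightarrow> N (matrix_pow A k) \<le> a ^ k"
  by (induction k) (auto intro: mult_mono)

lemma commutator_mono: "N A \<le> a \<Longrightarrow> N B \<le> b \<Longrightarrow> N (commutator A B) \<le> 2 * a * b"
  unfolding commutator_def
  using diff_mono[OF mult_mono[of A a B b] mult_mono[of B b A a]] by (simp add: mult_ac)

text \<open>Series converge in the standard \<open>norm\<close> but are estimated in
  \<open>N\<close>; expansion in the finite \<open>Basis\<close> links the two.\<close>

lemma bounded: "\<exists>C. \<forall>A. N A \<le> C * norm A"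
proof (intro exI allI)
  fix A
  have "N A = N (\<Sum>b\<in>Basis. (A \<bullet> b) *\<^sub>R b)" by (simp add: euclidean_representation)
  also have "\<dots> \<le> (\<Sum>b\<in>Basis. \<bar>A \<bullet> b\<bar> * N b)" using sum_le by (rule order_trans) simp
  also have "\<dots> \<le> (\<Sum>b\<in>Basis. norm A * N b)"
    by (intro sum_mono mult_right_mono) (auto simp: Basis_le_norm)
  finally show "N A \<le> (\<Sum>b\<in>Basis. N b) * norm A"
    by (simp add: sum_distrib_left mult.commute)
qed

text \<open>Partial sums are dominated by those of \<open>g\<close>, and the remainder tends to 0 in
  \<open>norm\<close>, hence in \<open>N\<close> by \<open>bounded\<close>.\<close>

lemma sums_le:
  assumes f: "f sums S" and g: "g sums t" and le: "\<And>k. N (f k) \<le> g k"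
  shows "N S \<le> t"
proof -
  obtain C where C: "\<And>A. N A \<le> C * norm A" using bounded by blast
  have "(\<lambda>n. (\<Sum>k<n. g k) + C * norm (S - (\<Sum>k<n. f k))) \<longlonglongrightarrow> t + C * norm (S - S)"
    using f g unfolding sums_def by (intro tendsto_intros)
  then have "N S \<le> t + C * norm (S - S)"
  proof (rule LIMSEQ_le_const, intro exI allI impI)
    fix n
    have "N S \<le> N (\<Sum>k<n. f k) + N (S - (\<Sum>k<n. f k))"
      using triangle[of "\<Sum>k<n. f k" "S - (\<Sum>k<n. f k)"] by simp
    also have "N (\<Sum>k<n. f k) \<le> (\<Sum>k<n. g k)"
      using sum_le by (rule order_trans) (intro sum_mono le)
    finally show "N S \<le> (\<Sum>k<n. g k) + C * norm (S - (\<Sum>k<n. f k))"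
      using C[of "S - (\<Sum>k<n. f k)"] by simp
  qed
  then show ?thesis by simp
qed

text \<open>Since \<open>fact k * fact m\<close> is at most \<open>fact (k + m)\<close>, the tail is
  dominated by \<open>u ^ m / fact m\<close> times a full exponential series. The general
  \<open>f\<close> covers a single exponential as well as a product of two.\<close>

lemma exp_series_tail:
  assumes f: "f sums S" and le: "\<And>k. N (f k) \<le> u ^ k / fact k" and u: "0 \<le> u"
  shows "N (S - (\<Sum>k<m. f k)) \<le> u ^ m / fact m * exp u"
proof (rule sums_le)
  show "(\<lambda>k. f (k + m)) sums (S - (\<Sum>k<m. f k))"
    using f by (rule sums_split_initial_segment)
  show "(\<lambda>k. u ^ m / fact m * (u ^ k /\<^sub>R fact k)) sums (u ^ m / fact m * exp u)"
    by (intro sums_mult exp_converges)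
  fix k
  have "fact k * fact m \<le> (fact (k + m) :: real)"
    by (metis fact_fact_dvd_fact dvd_imp_le fact_gt_zero of_nat_fact of_nat_le_iff of_nat_mult)
  then have "u ^ (k + m) / fact (k + m) \<le> u ^ (k + m) / (fact k * fact m)"
    using u by (intro divide_left_mono) auto
  also have "\<dots> = u ^ m / fact m * (u ^ k /\<^sub>R fact k)"
    by (simp add: power_add field_simps)
  finally show "N (f (k + m)) \<le> u ^ m / fact m * (u ^ k /\<^sub>R fact k)"
    using le[of "k + m"] by simp
qed

lemma matrix_exp_tail:
  assumes "N A \<le> u"
  shows "N (matrix_exp A - (\<Sum>k<m. matrix_pow A k /\<^sub>R fact k)) \<le> u ^ m / fact m * exp u"
proof (rule exp_series_tail[OF matrix_exp_sums])
  show "0 \<le> u" using assms nonneg[of A] by linarith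
  show "N (matrix_pow A k /\<^sub>R fact k) \<le> u ^ k / fact k" for k
    using pow_mono[OF assms, of k] by (simp add: field_simps)
qed

lemma matrix_exp_le: "N A \<le> u \<Longrightarrow> N (matrix_exp A) \<le> exp u"
  using matrix_exp_tail[of A u 0] by simp

text \<open>By the binomial theorem the degree \<open>k\<close> block of the Cauchy product has the
  majorant of a single exponential with bound \<open>a + b\<close>.\<close>

lemma matrix_exp_product_tail:
  assumes "N A \<le> a" "N B \<le> b"
  shows "N (matrix_exp A ** matrix_exp B -
      (\<Sum>k<m. \<Sum>p\<le>k. (matrix_pow A p /\<^sub>R fact p) ** (matrix_pow B (k - p) /\<^sub>R fact (k - p))))
    \<le> (a + b) ^ m / fact m * exp (a + b)"
proof (rule exp_series_tail[OF matrix_exp_Cauchy_product])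
  show "0 \<le> a + b" using assms nonneg[of A] nonneg[of B] by linarith
  fix k
  have pow: "N (matrix_pow C p /\<^sub>R fact p) \<le> c ^ p / fact p" if "N C \<le> c" for C c p
    using pow_mono[OF that, of p] by (simp add: field_simps)
  have "N (\<Sum>p\<le>k. (matrix_pow A p /\<^sub>R fact p) ** (matrix_pow B (k - p) /\<^sub>R fact (k - p)))
      \<le> (\<Sum>p\<le>k. (a ^ p / fact p) * (b ^ (k - p) / fact (k - p)))"
    using sum_le by (rule order_trans) (intro sum_mono mult_mono pow assms)
  also have "\<dots> = (a + b) ^ k / fact k"
    by (simp add: binomial_ring sum_divide_distrib binomial_fact field_simps)
  finally show "N (\<Sum>p\<le>k. (matrix_pow A p /\<^sub>R fact p) ** (matrix_pow B (k - p) /\<^sub>R fact (k - p)))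
      \<le> (a + b) ^ k / fact k" .
qed

text \<open>Telescoping: factors are exchanged one at a time, and each of the \<open>Suc k\<close>
  differences keeps \<open>k\<close> further factors bounded by \<open>u\<close>.\<close>

lemma pow_diff_le:
  assumes "N A \<le> u" "N B \<le> u"
  shows "N (matrix_pow A (Suc k) - matrix_pow B (Suc k)) \<le> real (Suc k) * N (A - B) * u ^ k"
proof (induction k)
  case (Suc k)
  have "matrix_pow A (Suc (Suc k)) - matrix_pow B (Suc (Suc k)) =
      A ** (matrix_pow A (Suc k) - matrix_pow B (Suc k)) + (A - B) ** matrix_pow B (Suc k)"
    by (simp add: matrix_algebra_simps)
  moreover have "N \<dots> \<le> u * (real (Suc k) * N (A - B) * u ^ k) + N (A - B) * u ^ Suc k"
    by (intro add_mono mult_mono assms Suc pow_mono order_refl)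
  ultimately show ?case by (simp add: algebra_simps)
qed simp

end

section \<open>Comparison of the two expansions up to degree 4\<close>

text \<open>The last commutator, with its sign, is the degree 4 term of the Baker-Campbell-Hausdorff
  series, which \<open>s + l + r\<close> omits. Both sides are expanded into words in
  \<open>x\<close> and \<open>y\<close>, and coefficients are compared.\<close>

lemma BCH_degree_4:
  fixes x y :: "complex ^ 'n ^ 'n"
  defines "s \<equiv> x + y" and "l \<equiv> (1/2) *\<^sub>R commutator x y"
    and "r \<equiv> (1/12) *\<^sub>R commutator x (commutator x y) - (1/12) *\<^sub>R commutator y (commutator x y)"
  shows "(\<Sum>k<5. \<Sum>p\<le>k. (matrix_pow x p /\<^sub>R fact p) ** (matrix_pow y (k - p) /\<^sub>R fact (k - p))) =
    mat 1 + (s + l + r) + (1/2) *\<^sub>R (s ** s + s ** l + l ** s + l ** l + s ** r + r ** s)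
    + (1/6) *\<^sub>R (s ** s ** s + s ** s ** l + s ** l ** s + l ** s ** s) + (1/24) *\<^sub>R (s ** s ** s ** s)
    - (1/24) *\<^sub>R commutator y (commutator x (commutator x y))"
  unfolding s_def l_def r_def commutator_def
  by (simp add: eval_nat_numeral lessThan_Suc atMost_Suc)
    (simp only: matrix_algebra_simps matrix_mul_lid matrix_mul_rid,
      simp only: matrix_entry_simps, simp add: field_simps scaleR_conv_of_real[where 'a = complex])

context submultiplicative_norm
begin

text \<open>
  Give \<open>s\<close>, \<open>l\<close>, \<open>r\<close> the degrees 1, 2, 3. What is subtracted is the part of
  \<open>matrix_exp (s + l + r)\<close> of degree at most 4; on the right \<open>u\<close> bounds \<open>s + l + r\<close>
  and \<open>w\<close> bounds \<open>l + r\<close>.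
\<close>

lemma matrix_exp_degree_4_remainder:
  assumes s: "N s \<le> b" and l: "N l \<le> c" and r: "N r \<le> d"
  defines "u \<equiv> b + c + d" and "w \<equiv> c + d"
  shows "N (matrix_exp (s + l + r) -
      (mat 1 + (s + l + r) + (1/2) *\<^sub>R (s ** s + s ** l + l ** s + l ** l + s ** r + r ** s)
      + (1/6) *\<^sub>R (s ** s ** s + s ** s ** l + s ** l ** s + l ** s ** s) + (1/24) *\<^sub>R (s ** s ** s ** s)))
    \<le> u ^ 5 / fact 5 * exp u + 1/24 * (u * u * u * w + u * u * w * b + u * w * b * b + w * b * b * b)
      + 1/6 * (b * b * d + (b * w + w * u) * w + (b * d * b + w * w * b) + d * b * b)
      + 1/2 * (c * d + d * c + d * d)"
proof -
  define z where "z = s + l + r"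
  define v where "v = l + r"
  have z: "N z \<le> u" unfolding z_def u_def by (intro add_mono s l r)
  have v: "N v \<le> w" unfolding v_def w_def by (intro add_mono l r)
  \<comment> \<open>With \<open>z = s + v\<close>, the factors \<open>z\<close> are replaced by
    \<open>s\<close> one by one from the right; every correction has one factor \<open>v\<close>,
    hence degree at least 5.\<close>
  have 4: "z ** z ** z ** z = s ** s ** s ** s + (z ** z ** z ** v + z ** z ** v ** s + z ** v ** s ** s + v ** s ** s ** s)"
    unfolding z_def v_def by (simp only: matrix_algebra_simps) (simp only: matrix_entry_simps, simp)
  \<comment> \<open>The remaining words have either one \<open>r\<close> and two \<open>s\<close>,
    or at least two factors \<open>v\<close>; both kinds have degree at least 5.\<close>
  have 3: "z ** z ** z = s ** s ** s + s ** s ** l + s ** l ** s + l ** s ** s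
      + (s ** s ** r + (s ** v + v ** z) ** v + (s ** r ** s + v ** v ** s) + r ** s ** s)"
    unfolding z_def v_def by (simp only: matrix_algebra_simps) (simp only: matrix_entry_simps, simp)
  have 2: "z ** z = s ** s + s ** l + l ** s + l ** l + s ** r + r ** s + (l ** r + r ** l + r ** r)"
    unfolding z_def by (simp only: matrix_algebra_simps) (simp only: matrix_entry_simps, simp)
  have S: "(\<Sum>k<5. matrix_pow z k /\<^sub>R fact k) = mat 1 + z + (1/2) *\<^sub>R (z ** z) + (1/6) *\<^sub>R (z ** z ** z)
      + (1/24) *\<^sub>R (z ** z ** z ** z)"
    by (simp add: eval_nat_numeral lessThan_Suc matrix_mul_assoc)
  \<comment> \<open>Solves the three identities for their remainders, so that \<open>eq\<close>
    becomes linear after rewriting.\<close>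
  have corr: "e = a - b" if "a = b + e" for a b e :: "complex ^ 'n ^ 'n"
    using that by simp
  have eq: "matrix_exp (s + l + r) -
      (mat 1 + (s + l + r) + (1/2) *\<^sub>R (s ** s + s ** l + l ** s + l ** l + s ** r + r ** s)
      + (1/6) *\<^sub>R (s ** s ** s + s ** s ** l + s ** l ** s + l ** s ** s) + (1/24) *\<^sub>R (s ** s ** s ** s))
    = (matrix_exp z - (\<Sum>k<5. matrix_pow z k /\<^sub>R fact k))
      + (1/24) *\<^sub>R (z ** z ** z ** v + z ** z ** v ** s + z ** v ** s ** s + v ** s ** s ** s)
      + (1/6) *\<^sub>R (s ** s ** r + (s ** v + v ** z) ** v + (s ** r ** s + v ** v ** s) + r ** s ** s)
      + (1/2) *\<^sub>R (l ** r + r ** l + r ** r)"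
    unfolding S 2[THEN corr] 3[THEN corr] 4[THEN corr] z_def[symmetric]
    by (simp add: scaleR_diff_right)
  have n4: "N (z ** z ** z ** v + z ** z ** v ** s + z ** v ** s ** s + v ** s ** s ** s)
      \<le> u * u * u * w + u * u * w * b + u * w * b * b + w * b * b * b"
    by (intro add_mono mult_mono s z v)
  have n3: "N (s ** s ** r + (s ** v + v ** z) ** v + (s ** r ** s + v ** v ** s) + r ** s ** s)
      \<le> b * b * d + (b * w + w * u) * w + (b * d * b + w * w * b) + d * b * b"
    by (intro add_mono mult_mono s r z v)
  have n2: "N (l ** r + r ** l + r ** r) \<le> c * d + d * c + d * d"
    by (intro add_mono mult_mono l r)
  have nn: "0 \<le> (1/24 :: real)" "0 \<le> (1/6 :: real)" "0 \<le> (1/2 :: real)" by simp_all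
  show ?thesis
    unfolding eq
    by (rule add_mono[OF add_mono[OF add_mono[OF matrix_exp_tail[OF z, of 5]
      scaleR_mono[OF n4 nn(1)]] scaleR_mono[OF n3 nn(2)]] scaleR_mono[OF n2 nn(3)]])
qed

end

section \<open>The scalar inequality behind the constant\<close>

text \<open>Here \<open>u\<close>, \<open>c\<close>, \<open>d\<close> bound \<open>s\<close>,
  \<open>l\<close>, \<open>r\<close>, and \<open>v\<close> stands where
  \<open>matrix_exp_degree_4_remainder\<close> has \<open>u\<close>. Every term contains
  \<open>u ^ 4\<close>; the other factors are absorbed into one exponential by suitably scaled uses
  of \<open>1 + t \<le> exp t\<close>.\<close>

lemma BCH_error_majorant:
  fixes u :: real
  assumes "0 \<le> u"
  defines "c \<equiv> u\<^sup>2 / 4" and "d \<equiv> u ^ 3 / 12"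
  defines "v \<equiv> u + c + d" and "w \<equiv> c + d"
  shows "u ^ 5 / fact 5 * exp u + u ^ 4 / 48 + (v ^ 5 / fact 5 * exp v
      + 1/24 * (v * v * v * w + v * v * w * u + v * w * u * u + w * u * u * u)
      + 1/6 * (u * u * d + (u * w + w * v) * w + (u * d * u + w * w * u) + d * u * u)
      + 1/2 * (c * d + d * c + d * d)) \<le> u ^ 4 / 4 * exp (3 * u + u\<^sup>2 + u ^ 3)"
proof -
  define E where "E = exp (3 * u + u\<^sup>2 + u ^ 3)"
  have E: "exp t \<le> E" if "t \<le> 3 * u + u\<^sup>2 + u ^ 3" for t
    using that by (simp add: E_def)
  have pos: "0 \<le> u\<^sup>2" "0 \<le> u ^ 3" "0 \<le> u ^ 4" using assms(1) by simp_all
  have "u * exp u \<le> exp u * exp u"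
    using exp_ge_add_one_self[of u] by (intro mult_right_mono) (linarith, simp)
  also have "\<dots> = exp (2 * u)" by (simp flip: exp_add)
  also have "\<dots> \<le> E" using assms(1) pos by (intro E) auto
  finally have t1: "u * exp u \<le> E" .
  \<comment> \<open>\<open>h\<close> is the relative excess of \<open>v\<close> over
    \<open>u\<close>, and \<open>k\<close> is \<open>h\<close> with a factor \<open>u\<close>
    removed.\<close>
  define h k where "h = u / 4 + u\<^sup>2 / 12" and "k = 1/4 + u / 12"
  have h: "0 \<le> h" using assms(1) by (simp add: h_def)
  have hk: "h = u * k" by (simp add: h_def k_def algebra_simps power2_eq_square)
  have v: "v = u * (1 + h)" and w: "w = u * h"
    unfolding v_def w_def c_def d_def h_def
    by (simp_all add: algebra_simps power2_eq_square power3_eq_cube)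
  have exp5: "(1 + h) ^ 5 \<le> exp (5 * h)" and exp3: "(1 + h) ^ 3 \<le> exp (3 * h)"
    using power_mono[OF exp_ge_add_one_self[of h], of 5] power_mono[OF exp_ge_add_one_self[of h], of 3] h
    by (simp_all flip: exp_of_nat_mult)
  \<comment> \<open>The scale 3/4 makes the coefficient of \<open>u\<close> in
    \<open>3/4 * u + 5 * h + v\<close> exactly 3.\<close>
  have t2: "u * (1 + h) ^ 5 * exp v \<le> 4/3 * E"
  proof -
    have "3/4 * u \<le> exp (3/4 * u)"
      using exp_ge_add_one_self[of "3/4 * u"] by linarith
    then have "(3/4 * u) * (1 + h) ^ 5 * exp v \<le> exp (3/4 * u) * exp (5 * h) * exp v"
      using assms(1) h by (intro mult_right_mono mult_mono exp5) auto
    also have "\<dots> = exp (3/4 * u + 5 * h + v)" by (simp only: exp_add)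
    also have "\<dots> \<le> E"
      using pos by (intro E) (simp add: h_def v_def c_def d_def field_simps)
    finally show ?thesis by simp
  qed
  \<comment> \<open>The scale 9 is chosen because \<open>9 * h + 3 * h\<close> equals
    \<open>3 * u + u ^ 2\<close>, which fits the exponent of \<open>E\<close>.\<close>
  have t3: "h * ((1 + h) ^ 3 + (1 + h)\<^sup>2 + (1 + h) + 1) \<le> 4/9 * E"
  proof -
    have "(1 + h) ^ j \<le> (1 + h) ^ 3" if "j \<le> 3" for j
      using that h by (intro power_increasing) auto
    from this[of 2] this[of 1] this[of 0] have "(1 + h) ^ 3 + (1 + h)\<^sup>2 + (1 + h) + 1 \<le> 4 * exp (3 * h)"
      using exp3 by simp
    moreover have "9 * h \<le> exp (9 * h)"
      using exp_ge_add_one_self[of "9 * h"] by linarith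
    ultimately have "(9 * h) * ((1 + h) ^ 3 + (1 + h)\<^sup>2 + (1 + h) + 1) \<le> exp (9 * h) * (4 * exp (3 * h))"
      using h by (intro mult_mono) auto
    also have "\<dots> = 4 * exp (12 * h)" by (simp flip: exp_add)
    also have "exp (12 * h) \<le> E"
      using pos by (intro E) (simp add: h_def)
    finally show ?thesis by simp
  qed
  \<comment> \<open>The product \<open>(6 * h) * (4 * k) * (1 + h / 3)\<close> is 8 times the left
    side, and \<open>4 * k\<close> is \<open>1 + u / 3\<close>.\<close>
  have t4: "h * k * (3 + h) \<le> 1/8 * E"
  proof -
    have "6 * h \<le> exp (6 * h)"
      using exp_ge_add_one_self[of "6 * h"] by linarith
    moreover have "4 * k \<le> exp (u / 3)"
      using exp_ge_add_one_self[of "u / 3"] by (simp add: k_def)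
    moreover have "1 + h / 3 \<le> exp (h / 3)"
      by (rule exp_ge_add_one_self)
    ultimately have "(6 * h) * (4 * k) * (1 + h / 3) \<le> exp (6 * h) * exp (u / 3) * exp (h / 3)"
      using h assms(1) by (intro mult_mono) (auto simp: k_def)
    also have "\<dots> = exp (6 * h + u / 3 + h / 3)" by (simp only: exp_add)
    also have "\<dots> \<le> E"
      using assms(1) pos by (intro E) (simp add: h_def field_simps)
    finally show ?thesis by (simp add: algebra_simps)
  qed
  have t5: "u \<le> E"
    using exp_ge_add_one_self[of u] E[of u] assms(1) pos by linarith
  have t6: "u * (1 + u / 6) \<le> E"
  proof -
    have "u \<le> exp u" "1 + u / 6 \<le> exp (u / 6)"
      using exp_ge_add_one_self[of u] exp_ge_add_one_self[of "u / 6"] by linarith+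
    then have "u * (1 + u / 6) \<le> exp u * exp (u / 6)"
      using assms(1) by (intro mult_mono) auto
    also have "\<dots> = exp (u + u / 6)" by (simp only: exp_add)
    also have "\<dots> \<le> E" using assms(1) pos by (intro E) linarith
    finally show ?thesis .
  qed
  have p1: "v * v * v * w + v * v * w * u + v * w * u * u + w * u * u * u
      = u ^ 4 * (h * ((1 + h) ^ 3 + (1 + h)\<^sup>2 + (1 + h) + 1))"
    unfolding v w by (simp add: eval_nat_numeral distrib_left mult_ac)
  have "u * u * d + (u * w + w * v) * w + (u * d * u + w * w * u) + d * u * u
      = 3 * u\<^sup>2 * d + u ^ 3 * h * h * (3 + h)"
    unfolding v w by (simp add: eval_nat_numeral algebra_simps)
  \<comment> \<open>Trading one \<open>h\<close> for \<open>u * k\<close> supplies the missing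
    fourth power of \<open>u\<close>.\<close>
  also have "\<dots> = 3 * u\<^sup>2 * d + u ^ 3 * h * (u * k) * (3 + h)"
    by (simp only: flip: hk)
  also have "\<dots> = u ^ 4 * (u / 4 + h * k * (3 + h))"
    unfolding d_def by (simp add: eval_nat_numeral distrib_left mult_ac)
  finally have p2: "u * u * d + (u * w + w * v) * w + (u * d * u + w * w * u) + d * u * u = \<dots>" .
  have p3: "c * d + d * c + d * d = u ^ 4 * (u * (1 + u / 6) / 24)"
    unfolding c_def d_def by (simp add: eval_nat_numeral field_simps)
  have p4: "u ^ 5 / fact 5 * exp u = u ^ 4 * (1/120 * (u * exp u))"
    by (simp add: fact_numeral eval_nat_numeral)
  have p5: "v ^ 5 / fact 5 * exp v = u ^ 4 * (1/120 * (u * (1 + h) ^ 5 * exp v))"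
    using v by (simp add: fact_numeral power_mult_distrib power_Suc2[of u 4, simplified])
  have "u ^ 5 / fact 5 * exp u + u ^ 4 / 48 + (v ^ 5 / fact 5 * exp v
      + 1/24 * (v * v * v * w + v * v * w * u + v * w * u * u + w * u * u * u)
      + 1/6 * (u * u * d + (u * w + w * v) * w + (u * d * u + w * w * u) + d * u * u)
      + 1/2 * (c * d + d * c + d * d))
    = u ^ 4 * (1/120 * (u * exp u) + 1/48 * 1 + (1/120 * (u * (1 + h) ^ 5 * exp v)
      + 1/24 * (h * ((1 + h) ^ 3 + (1 + h)\<^sup>2 + (1 + h) + 1))
      + 1/6 * (1/4 * u + h * k * (3 + h)) + 1/2 * (1/24 * (u * (1 + u / 6)))))"
    unfolding p1 p2 p3 p4 p5 by (simp add: field_simps)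
  \<comment> \<open>The constant 1/48 is covered by \<open>1 \<le> E\<close>. The coefficients of
    \<open>E\<close> add up to 307/2160, which is below 1/4.\<close>
  also have "\<dots> \<le> u ^ 4 * (1/120 * E + 1/48 * E + (1/120 * (4/3 * E) + 1/24 * (4/9 * E)
      + 1/6 * (1/4 * E + 1/8 * E) + 1/2 * (1/24 * E)))"
    using E[of 0] assms(1) pos by (intro mult_left_mono add_mono t1 t2 t3 t4 t5 t6) auto
  also have "\<dots> \<le> u ^ 4 * (1/4 * E)"
    using E[of 0] assms(1) pos by (intro mult_left_mono) auto
  finally show ?thesis by (simp add: E_def)
qed

section \<open>Telescoping, and the passage from \<open>u\<close> back to \<alpha>\<close>

theorem proposition5p2:
  fixes A1 A2 :: "complex ^ 'n ^ 'n"
    and N :: "complex ^ 'n ^ 'n \<Rightarrow> real"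
    and \<alpha> :: real
    and n :: nat
  assumes "submultiplicative_matrix_norm N"
    and "\<alpha> \<ge> 0"
    and "N A1 \<le> \<alpha> / 2"
    and "N A2 \<le> \<alpha> / 2"
    and "n \<ge> 1"
  shows
    "let avg = A1 + A2;
         L = (1/2) *\<^sub>R commutator A1 A2;
         R = (1/12) *\<^sub>R commutator A1 (commutator A1 A2)
             - (1/12) *\<^sub>R commutator A2 (commutator A1 A2);
         a = \<alpha> ^ 4 / 4 * exp (3 * \<alpha>) * exp (\<alpha> ^ 2) * exp (\<alpha> ^ 3)
     in N (matrix_pow (matrix_exp (A1 /\<^sub>R real n) ** matrix_exp (A2 /\<^sub>R real n)) n
           - matrix_exp (avg + L /\<^sub>R real n + R /\<^sub>R (real n ^ 2)))
        \<le> a / real n ^ 3"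
proof -
  interpret submultiplicative_norm N by unfold_locales fact
  define u x y where "u = \<alpha> / n" and "x = A1 /\<^sub>R real n" and "y = A2 /\<^sub>R real n"
  define s l r where "s = x + y" and "l = (1/2) *\<^sub>R commutator x y"
    and "r = (1/12) *\<^sub>R commutator x (commutator x y) - (1/12) *\<^sub>R commutator y (commutator x y)"
  define F G where "F = matrix_exp x ** matrix_exp y" and "G = matrix_exp (s + l + r)"
  \<comment> \<open>The sum of the bounds on \<open>s\<close>, \<open>l\<close> and
    \<open>r\<close>; \<open>exp v\<close> serves as the common bound on \<open>F\<close> and
    \<open>G\<close> in the telescoping.\<close>
  define v where "v = u + u\<^sup>2 / 4 + u ^ 3 / 12"
  obtain m where m: "n = Suc m" using assms(5) by (cases n) auto
  have n: "real n > 0" "real n \<ge> 1" using assms(5) by auto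
  have \<alpha>: "\<alpha> = n * u" using n by (simp add: u_def)
  have u: "0 \<le> u" using assms(2) by (simp add: u_def)
  have x: "N x \<le> u / 2" and y: "N y \<le> u / 2"
    using assms(3,4) n by (simp_all add: x_def y_def u_def field_simps)
  have xy: "N (commutator x y) \<le> u\<^sup>2 / 2"
    using commutator_mono[OF x y] by (simp add: power2_eq_square)
  have s: "N s \<le> u"
    using add_mono[OF x y] by (simp add: s_def)
  have l: "N l \<le> u\<^sup>2 / 4"
    using xy by (simp add: l_def)
  have xxy: "N (commutator x (commutator x y)) \<le> u ^ 3 / 2"
    and yxy: "N (commutator y (commutator x y)) \<le> u ^ 3 / 2"
    using commutator_mono[OF x xy] commutator_mono[OF y xy]
    by (simp_all add: power2_eq_square power3_eq_cube)
  have r: "N r \<le> u ^ 3 / 12"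
    using diff_mono[OF scaleR_mono[OF xxy, of "1/12"] scaleR_mono[OF yxy, of "1/12"]] by (simp add: r_def)
  have yxxy: "N ((1/24) *\<^sub>R commutator y (commutator x (commutator x y))) \<le> u ^ 4 / 48"
    using commutator_mono[OF y xxy] by (simp add: eval_nat_numeral)
  have F: "N F \<le> exp v"
  proof -
    have "N F \<le> exp (u / 2) * exp (u / 2)"
      unfolding F_def by (intro mult_mono matrix_exp_le x y)
    also have "\<dots> = exp u" by (simp flip: exp_add)
    also have "\<dots> \<le> exp v" using u by (simp add: v_def)
    finally show ?thesis .
  qed
  have G: "N G \<le> exp v"
    unfolding G_def v_def by (intro matrix_exp_le add_mono s l r)
  have FG: "N (F - G) \<le> u ^ 4 / 4 * exp (3 * u + u\<^sup>2 + u ^ 3)"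
  proof -
    define P where "P = (\<Sum>k<5. \<Sum>p\<le>k. (matrix_pow x p /\<^sub>R fact p) ** (matrix_pow y (k - p) /\<^sub>R fact (k - p)))"
    define Q where "Q = mat 1 + (s + l + r) + (1/2) *\<^sub>R (s ** s + s ** l + l ** s + l ** l + s ** r + r ** s)
      + (1/6) *\<^sub>R (s ** s ** s + s ** s ** l + s ** l ** s + l ** s ** s) + (1/24) *\<^sub>R (s ** s ** s ** s)"
    have PQ: "P = Q - (1/24) *\<^sub>R commutator y (commutator x (commutator x y))"
      unfolding P_def Q_def s_def l_def r_def by (rule BCH_degree_4)
    have "N (F - P) \<le> (u / 2 + u / 2) ^ 5 / fact 5 * exp (u / 2 + u / 2)"
      unfolding F_def P_def by (rule matrix_exp_product_tail[OF x y])
    then have FP: "N (F - P) \<le> u ^ 5 / fact 5 * exp u" by simp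
    note GQ = matrix_exp_degree_4_remainder[OF s l r, folded Q_def G_def]
    \<comment> \<open>The two tails and the exact degree 4 discrepancy between \<open>P\<close> and
      \<open>Q\<close>.\<close>
    have eq: "F - G = (F - P) - (1/24) *\<^sub>R commutator y (commutator x (commutator x y)) - (G - Q)"
      by (simp add: PQ)
    show ?thesis
      unfolding eq using diff_mono[OF diff_mono[OF FP yxxy] GQ] BCH_error_majorant[OF u]
      by (rule order_trans)
  qed
  have "matrix_pow G n = matrix_exp (n *\<^sub>R (s + l + r))"
    unfolding G_def by (rule matrix_pow_exp)
  \<comment> \<open>The parts \<open>s\<close>, \<open>l\<close>, \<open>r\<close> are homogeneous
    of degrees 1, 2, 3 in \<open>1 / n\<close>, so multiplication by \<open>n\<close> leaves degrees
    0, 1, 2.\<close>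
  also have "n *\<^sub>R (s + l + r) = A1 + A2 + ((1/2) *\<^sub>R commutator A1 A2) /\<^sub>R real n
      + ((1/12) *\<^sub>R commutator A1 (commutator A1 A2)
          - (1/12) *\<^sub>R commutator A2 (commutator A1 A2)) /\<^sub>R (real n ^ 2)"
    using n unfolding s_def l_def r_def x_def y_def commutator_def
    by (simp only: matrix_algebra_simps) (simp only: matrix_entry_simps, simp add: field_simps power2_eq_square)
  finally have Gn: "matrix_pow G n = matrix_exp \<dots>" .
  have "N (matrix_pow F n - matrix_pow G n) \<le> n * N (F - G) * exp v ^ m"
    unfolding m by (rule pow_diff_le[OF F G])
  also have "\<dots> \<le> n * (u ^ 4 / 4 * exp (3 * u + u\<^sup>2 + u ^ 3)) * exp v ^ m"
    using FG by (intro mult_right_mono mult_left_mono) auto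
  also have "\<dots> = n * (u ^ 4 / 4) * exp (3 * u + u\<^sup>2 + u ^ 3 + m * v)"
    by (simp add: exp_add exp_of_nat_mult)
  \<comment> \<open>As \<open>v\<close> is at most \<open>3 * u + u ^ 2 + u ^ 3\<close>, the
    exponent is at most \<open>n\<close> copies of the latter; \<open>n \<ge> 1\<close> then allows
    \<open>n\<close> to be raised to the powers that turn \<open>n * u\<close> into
    \<alpha>.\<close>
  also have "\<dots> \<le> n * (u ^ 4 / 4) * exp (3 * \<alpha> + \<alpha>\<^sup>2 + \<alpha> ^ 3)"
  proof -
    have "m * v \<le> m * (3 * u + u\<^sup>2 + u ^ 3)"
      using u unfolding v_def by (intro mult_left_mono Groups.add_mono) auto
    then have "3 * u + u\<^sup>2 + u ^ 3 + m * v \<le> 3 * (n * u) + n * u\<^sup>2 + n * u ^ 3"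
      by (simp add: m algebra_simps)
    also have "\<dots> \<le> 3 * \<alpha> + \<alpha>\<^sup>2 + \<alpha> ^ 3"
      using n u self_le_power[of "real n" 2] self_le_power[of "real n" 3] unfolding \<alpha> power_mult_distrib
      by (intro Groups.add_mono mult_right_mono) auto
    finally show ?thesis using u by (intro mult_left_mono) auto
  qed
  \<comment> \<open>The decay rate comes from
    \<open>n * u ^ 4 = \<alpha> ^ 4 / n ^ 3\<close>.\<close>
  also have "\<dots> = \<alpha> ^ 4 / 4 * exp (3 * \<alpha>) * exp (\<alpha>\<^sup>2) * exp (\<alpha> ^ 3) / real n ^ 3"
    using n by (simp add: u_def exp_add field_simps) (simp add: eval_nat_numeral)
  finally show ?thesis
    unfolding Let_def Gn F_def x_def y_def .
qed

end
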